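(* Let $\gamma>0$. There exist a Hilbert space $\mathcal{H}$ and a closed, proper, and convex function $f$ on $\mathcal{H}$ with a minimizer $x^\ast$ such that for all $\alpha>1/2$ there exists $z^0\in\mathcal{H}$ such that if $(z^j)_{j\ge0}$ is generated by the proximal point algorithm $z^{k+1}=\mathbf{prox}_{\gamma f}(z^k)$, then $$\|\mathbf{prox}_{\gamma f}(z^k)-z^k\|^2\ge\frac{\gamma^2}{(1+2\alpha)e^{2\gamma}(k+\gamma)^{1+2\alpha}}\quad\text{for all }k\ge1,$$ and $$f(z^{k+1})-f(x^\ast)\ge\frac{1}{4\alpha e^{2\gamma}(k+1+\gamma)^{2\alpha}}\quad\text{for all }k\ge0.$$
   Context: $\mathbf{prox}_{\gamma f}(x):=\arg\min_{y\in\mathcal{H}}f(y)+\frac{1}{2\gamma}\|y-x\|^2$. *)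

theory Defs
  imports "HOL-Analysis.Analysis" "HOL-Library.Function_Algebras"
begin

text \<open>
  A statement cannot quantify existentially over types, so "there exists a Hilbert space" is
  expressed by quantifying over pairs \<open>(V, ip)\<close>: a linear subspace \<open>V\<close> of an ambient
  real vector space together with an inner product \<open>ip\<close> on \<open>V\<close> that makes it complete.
  The ambient space carries no topology; that of \<open>V\<close> comes from \<open>ip\<close> alone.
  With \<open>nat \<Rightarrow> real\<close> as ambient space this covers every separable real Hilbert space
  up to isometry.
\<close>

instantiation "fun" :: (type, real_vector) real_vector
begin

definition scaleR_fun :: "real \<Rightarrow> ('a \<Rightarrow> 'b) \<Rightarrow> 'a \<Rightarrow> 'b"
  where "scaleR_fun c f = (\<lambda>x. c *\<^sub>R f x)"

instance
  by standard (auto simp: scaleR_fun_def fun_eq_iff algebra_simps)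

end

lemma scaleR_fun_apply [simp]: "(c *\<^sub>R f) x = c *\<^sub>R f x"
  by (simp add: scaleR_fun_def)

definition ip_norm :: "('a \<Rightarrow> 'a \<Rightarrow> real) \<Rightarrow> 'a \<Rightarrow> real"
  where "ip_norm ip x = sqrt (ip x x)"

text \<open>
  The library's \<open>Metric_space\<close> requires nonnegativity and symmetry on the whole type,
  hence the default value outside \<open>V\<close>, where \<open>ip\<close> is unconstrained.
\<close>

definition ip_dist :: "'a::real_vector set \<Rightarrow> ('a \<Rightarrow> 'a \<Rightarrow> real) \<Rightarrow> 'a \<Rightarrow> 'a \<Rightarrow> real"
  where "ip_dist V ip x y = (if x \<in> V \<and> y \<in> V then ip_norm ip (x - y) else 0)"

locale inner_product_on =
  fixes V :: "'a::real_vector set" and ip :: "'a \<Rightarrow> 'a \<Rightarrow> real"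
  assumes subspace: "subspace V"
    and ip_commute: "x \<in> V \<Longrightarrow> y \<in> V \<Longrightarrow> ip x y = ip y x"
    and ip_add_left: "x \<in> V \<Longrightarrow> y \<in> V \<Longrightarrow> w \<in> V \<Longrightarrow> ip (x + y) w = ip x w + ip y w"
    and ip_scaleR_left: "x \<in> V \<Longrightarrow> y \<in> V \<Longrightarrow> ip (c *\<^sub>R x) y = c * ip x y"
    and ip_pos: "x \<in> V \<Longrightarrow> x \<noteq> 0 \<Longrightarrow> 0 < ip x x"
begin

lemma ip_zero: "ip 0 0 = 0"
  using ip_scaleR_left[of 0 0 0] subspace_0[OF subspace] by simp

lemma ip_ge_zero: "x \<in> V \<Longrightarrow> 0 \<le> ip x x"
  using ip_pos[of x] ip_zero by (cases "x = 0") auto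

lemma ip_self_add_scaleR:
  assumes "x \<in> V" "y \<in> V"
  shows "ip (x + c *\<^sub>R y) (x + c *\<^sub>R y) = ip x x + 2 * c * ip x y + c\<^sup>2 * ip y y"
proof -
  have V: "c *\<^sub>R y \<in> V" "x + c *\<^sub>R y \<in> V"
    using assms subspace by (auto intro: subspace_add subspace_scale)
  have *: "ip w (x + c *\<^sub>R y) = ip x w + c * ip y w" if "w \<in> V" for w
    using that V assms by (simp add: ip_commute[of w] ip_add_left ip_scaleR_left)
  show ?thesis
    using V assms ip_commute[of y x]
    by (simp add: ip_add_left ip_scaleR_left * power2_eq_square algebra_simps)
qed

lemma ip_Cauchy_Schwarz:
  assumes "x \<in> V" "y \<in> V"
  shows "ip x y \<le> ip_norm ip x * ip_norm ip y"
proof (cases "y = 0")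
  case True
  then show ?thesis
    using assms ip_scaleR_left[of y x 0] ip_zero ip_commute[of x y]
    by (simp add: ip_norm_def)
next
  case False
  then have pos: "0 < ip y y" using ip_pos assms by simp
  define c where "c = - (ip x y / ip y y)"
  have "0 \<le> ip (x + c *\<^sub>R y) (x + c *\<^sub>R y)"
    using assms subspace by (intro ip_ge_zero subspace_add subspace_scale)
  also have "\<dots> = ip x x - (ip x y)\<^sup>2 / ip y y"
    unfolding ip_self_add_scaleR[OF assms] c_def using pos
    by (simp add: power2_eq_square field_simps)
  finally have "(ip x y)\<^sup>2 \<le> ip x x * ip y y"
    using pos by (simp add: field_simps)
  then have "\<bar>ip x y\<bar> \<le> sqrt (ip x x * ip y y)"
    by (metis real_sqrt_abs real_sqrt_le_mono)
  then show ?thesis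
    by (simp add: ip_norm_def real_sqrt_mult)
qed

lemma ip_norm_triangle:
  assumes "x \<in> V" "y \<in> V"
  shows "ip_norm ip (x + y) \<le> ip_norm ip x + ip_norm ip y"
proof -
  have "ip (x + y) (x + y) = ip x x + 2 * ip x y + ip y y"
    using ip_self_add_scaleR[OF assms, of 1] by simp
  also have "\<dots> \<le> (ip_norm ip x + ip_norm ip y)\<^sup>2"
    using ip_Cauchy_Schwarz[OF assms] ip_ge_zero assms
    by (simp add: ip_norm_def power2_sum)
  finally show ?thesis
    unfolding ip_norm_def[of _ "x + y"]
    using ip_ge_zero assms by (intro real_le_lsqrt) (auto simp: ip_norm_def)
qed

lemma Metric_space_ip_dist: "Metric_space V (ip_dist V ip)"
proof
  fix x y
  show "0 \<le> ip_dist V ip x y"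
    using ip_ge_zero subspace by (simp add: ip_dist_def ip_norm_def subspace_diff)
  have "ip (x - y) (x - y) = ip (y - x) (y - x)" if "x \<in> V" "y \<in> V"
  proof -
    have V: "x - y \<in> V" using that subspace by (simp add: subspace_diff)
    then show ?thesis
      using ip_self_add_scaleR[OF subspace_0[OF subspace] V, of "-1"]
        ip_zero ip_scaleR_left[of 0 "x - y" 0] subspace_0[OF subspace] by simp
  qed
  then show "ip_dist V ip x y = ip_dist V ip y x"
    by (auto simp: ip_dist_def ip_norm_def)
next
  fix x y assume "x \<in> V" "y \<in> V"
  then show "(ip_dist V ip x y = 0) = (x = y)"
    using ip_pos[of "x - y"] ip_zero subspace
    by (cases "x = y") (simp_all add: ip_dist_def ip_norm_def subspace_diff)
next
  fix x y w assume "x \<in> V" "y \<in> V" "w \<in> V"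
  then show "ip_dist V ip x w \<le> ip_dist V ip x y + ip_dist V ip y w"
    using ip_norm_triangle[of "x - y" "y - w"] subspace
    by (simp add: ip_dist_def subspace_diff)
qed

end

locale hilbert_space_on = inner_product_on +
  assumes complete: "Metric_space.mcomplete V (ip_dist V ip)"

text \<open>
  Extended real valued functions on \<open>V\<close>; their values outside \<open>V\<close> are irrelevant.
\<close>

definition epigraph_on :: "'a set \<Rightarrow> ('a \<Rightarrow> ereal) \<Rightarrow> ('a \<times> real) set"
  where "epigraph_on V f = {(x, r). x \<in> V \<and> f x \<le> ereal r}"

definition closed_fun_on ::
    "'a::real_vector set \<Rightarrow> ('a \<Rightarrow> 'a \<Rightarrow> real) \<Rightarrow> ('a \<Rightarrow> ereal) \<Rightarrow> bool"
  where "closed_fun_on V ip f \<longleftrightarrow>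
    closedin (prod_topology (Metric_space.mtopology V (ip_dist V ip)) euclideanreal)
      (epigraph_on V f)"

definition proper_fun_on :: "'a set \<Rightarrow> ('a \<Rightarrow> ereal) \<Rightarrow> bool"
  where "proper_fun_on V f \<longleftrightarrow> (\<forall>x\<in>V. f x \<noteq> - \<infinity>) \<and> (\<exists>x\<in>V. f x \<noteq> \<infinity>)"

definition convex_fun_on :: "'a::real_vector set \<Rightarrow> ('a \<Rightarrow> ereal) \<Rightarrow> bool"
  where "convex_fun_on V f \<longleftrightarrow> convex (epigraph_on V f)"

text \<open>
  For \<open>\<gamma> > 0\<close> and \<open>f\<close> closed, proper and convex on a Hilbert space, the objective is
  strongly convex and has exactly one minimizer, so \<open>arg_min\<close> involves no arbitrary choice.
\<close>

definition prox ::
    "'a::real_vector set \<Rightarrow> ('a \<Rightarrow> 'a \<Rightarrow> real) \<Rightarrow> real \<Rightarrow> ('a \<Rightarrow> ereal) \<Rightarrow> 'a \<Rightarrow> 'a"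
  where "prox V ip \<gamma> f x =
    arg_min (\<lambda>y. f y + ereal (1 / (2 * \<gamma>) * (ip_norm ip (y - x))\<^sup>2)) (\<lambda>y. y \<in> V)"

end

theory Submission
  imports Defs
begin

text \<open>
  On \<open>\<ell>\<^sup>2\<close> take \<open>f x = 1/2 * (\<Sum>i\<ge>1. x\<^sub>i\<^sup>2 / i)\<close>. Its proximal map is diagonal and multiplies the
  \<open>i\<close>-th coordinate by \<open>i / (i + \<gamma>)\<close>, so the iterates from \<open>z\<^sup>0\<^sub>i = (i + \<gamma>) powr - \<alpha>\<close> are explicit.
  For \<open>i \<ge> k\<close> the factor \<open>(i / (i + \<gamma>)) ^ (2 * k)\<close> is at least \<open>exp (- 2 * \<gamma>)\<close>; dropping all
  coordinates below \<open>k\<close> and bounding the remaining tail below by a telescoping sum gives both bounds.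
  Coordinates are numbered from \<open>0\<close> below, so \<open>i\<close> appears as \<open>n + 1\<close>.
\<close>

section \<open>The Hilbert space of square-summable sequences\<close>

definition l2 :: "(nat \<Rightarrow> real) set"
  where "l2 = {x. summable (\<lambda>n. (x n)\<^sup>2)}"

definition l2_inner :: "(nat \<Rightarrow> real) \<Rightarrow> (nat \<Rightarrow> real) \<Rightarrow> real"
  where "l2_inner x y = (\<Sum>n. x n * y n)"

lemma summable_l2_mult:
  assumes "x \<in> l2" "y \<in> l2"
  shows "summable (\<lambda>n. x n * y n)"
proof (rule summable_comparison_test')
  show "summable (\<lambda>n. (x n)\<^sup>2 + (y n)\<^sup>2)"
    using assms by (simp add: l2_def summable_add)
  have "\<bar>a * b\<bar> \<le> a\<^sup>2 + b\<^sup>2" for a b :: real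
  proof -
    have "2 * (\<bar>a\<bar> * \<bar>b\<bar>) \<le> a\<^sup>2 + b\<^sup>2"
      using sum_squares_bound[of "\<bar>a\<bar>" "\<bar>b\<bar>"] by (simp add: mult.assoc)
    moreover have "0 \<le> \<bar>a\<bar> * \<bar>b\<bar>"
      by simp
    ultimately show ?thesis
      unfolding abs_mult by linarith
  qed
  then show "norm (x n * y n) \<le> (x n)\<^sup>2 + (y n)\<^sup>2" for n
    by simp
qed

lemma subspace_l2: "subspace l2"
  unfolding subspace_def
proof (intro conjI ballI allI)
  show "0 \<in> l2"
    by (simp add: l2_def)
next
  fix x y assume "x \<in> l2" "y \<in> l2"
  moreover have "summable (\<lambda>n. (x n)\<^sup>2 + (y n)\<^sup>2 + 2 * (x n * y n))"
    using \<open>x \<in> l2\<close> \<open>y \<in> l2\<close> summable_l2_mult[of x y]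
    by (intro summable_add summable_mult) (auto simp: l2_def)
  ultimately show "x + y \<in> l2"
    by (simp add: l2_def power2_sum mult.assoc)
next
  fix c :: real and x assume "x \<in> l2"
  then show "c *\<^sub>R x \<in> l2"
    by (simp add: l2_def power_mult_distrib summable_mult)
qed

lemma l2_inner_self: "l2_inner x x = (\<Sum>n. (x n)\<^sup>2)"
  by (simp add: l2_inner_def power2_eq_square)

lemma l2_norm_power2: "(ip_norm l2_inner x)\<^sup>2 = (\<Sum>n. (x n)\<^sup>2)" if "x \<in> l2"
  using that by (simp add: ip_norm_def l2_inner_self l2_def suminf_nonneg)

interpretation l2: inner_product_on l2 l2_inner
proof
  show "subspace l2"
    by (rule subspace_l2)
  show "l2_inner x y = l2_inner y x" for x y
    by (simp add: l2_inner_def mult.commute)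
  show "l2_inner (x + y) w = l2_inner x w + l2_inner y w"
    if "x \<in> l2" "y \<in> l2" "w \<in> l2" for x y w
    using suminf_add[OF summable_l2_mult summable_l2_mult, of x w y w] that
    by (simp add: l2_inner_def distrib_right)
  show "l2_inner (c *\<^sub>R x) y = c * l2_inner x y" if "x \<in> l2" "y \<in> l2" for c x y
    using suminf_mult[OF summable_l2_mult, of x y c] that
    by (simp add: l2_inner_def mult.assoc)
  show "0 < l2_inner x x" if "x \<in> l2" "x \<noteq> 0" for x
  proof -
    from \<open>x \<noteq> 0\<close> obtain i where "x i \<noteq> 0"
      by (auto simp: fun_eq_iff)
    with \<open>x \<in> l2\<close> show ?thesis
      unfolding l2_inner_self by (intro suminf_pos2[of _ i]) (auto simp: l2_def)
  qed
qed

interpretation l2_metric: Metric_space l2 "ip_dist l2 l2_inner"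
  by (rule l2.Metric_space_ip_dist)

text \<open>The terms are nonnegative, so bounded partial sums converge, with limit below the same
  bound. Membership is a conclusion here, which allows application to a coordinatewise limit not yet
  known to lie in \<open>l2\<close>.\<close>

lemma l2_norm_leI:
  assumes "\<And>K. (\<Sum>n<K. (x n)\<^sup>2) \<le> c\<^sup>2" "0 \<le> c"
  shows "x \<in> l2" "ip_norm l2_inner x \<le> c"
proof -
  show x: "x \<in> l2"
    unfolding l2_def mem_Collect_eq
    by (rule bounded_imp_summable[where B = "c\<^sup>2"])
       (use assms(1) in \<open>auto simp flip: lessThan_Suc_atMost simp del: sum.lessThan_Suc\<close>)
  have "(\<Sum>n. (x n)\<^sup>2) \<le> c\<^sup>2"
    using x assms(1) by (intro suminf_le_const) (auto simp: l2_def)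
  then show "ip_norm l2_inner x \<le> c"
    unfolding ip_norm_def l2_inner_self using assms(2) by (simp add: real_le_lsqrt)
qed

lemma sum_le_l2_norm:
  assumes "x \<in> l2"
  shows "(\<Sum>n<K. (x n)\<^sup>2) \<le> (ip_norm l2_inner x)\<^sup>2"
  unfolding l2_norm_power2[OF assms] using assms by (intro sum_le_suminf) (auto simp: l2_def)

lemma abs_coordinate_le_l2_norm:
  assumes "x \<in> l2"
  shows "\<bar>x i\<bar> \<le> ip_norm l2_inner x"
proof -
  have "(x i)\<^sup>2 \<le> (\<Sum>n<Suc i. (x n)\<^sup>2)"
    by (simp add: sum_nonneg)
  also have "\<dots> \<le> (ip_norm l2_inner x)\<^sup>2"
    by (rule sum_le_l2_norm[OF assms])
  finally show ?thesis
    by (rule abs_le_square_iff[THEN iffD2, THEN order_trans])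
       (simp add: ip_norm_def l2.ip_ge_zero[OF assms])
qed

text \<open>Coordinates are 1-Lipschitz. This makes them Cauchy in the completeness proof and
  continuous in the proof that the epigraph is closed.\<close>

lemma coordinate_diff_le_l2_dist:
  assumes "x \<in> l2" "y \<in> l2"
  shows "\<bar>x i - y i\<bar> \<le> ip_dist l2 l2_inner x y"
  using abs_coordinate_le_l2_norm[of "x - y" i] assms
  by (simp add: ip_dist_def subspace_diff[OF subspace_l2])

text \<open>The candidate limit is taken coordinate by coordinate. The Cauchy estimate is first
  restricted to finitely many coordinates, where passing to the limit is harmless, and then extended
  to the whole norm.\<close>

lemma mcomplete_l2: "l2_metric.mcomplete"
  unfolding l2_metric.mcomplete_def
proof (intro allI impI)
  fix \<sigma> assume "l2_metric.MCauchy \<sigma>"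
  then have in_l2: "\<And>n. \<sigma> n \<in> l2"
    and Cauchy: "\<And>\<epsilon>. \<epsilon> > 0 \<Longrightarrow> \<exists>N. \<forall>n m. N \<le> n \<longrightarrow> N \<le> m \<longrightarrow> ip_dist l2 l2_inner (\<sigma> n) (\<sigma> m) < \<epsilon>"
    by (auto simp: l2_metric.MCauchy_def)
  have "Cauchy (\<lambda>n. \<sigma> n i)" for i
    unfolding Cauchy_def dist_real_def
    using Cauchy coordinate_diff_le_l2_dist[OF in_l2 in_l2, of _ i] by (meson le_less_trans)
  then have "\<exists>l. (\<lambda>n. \<sigma> n i) \<longlonglongrightarrow> l" for i
    by (simp add: Cauchy_convergent convergentD)
  then obtain x where x: "\<And>i. (\<lambda>n. \<sigma> n i) \<longlonglongrightarrow> x i"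
    by metis
  \<comment> \<open>Membership of \<open>\<sigma> n - x\<close> has to be proved along with the
    bound, as \<open>x \<in> l2\<close> is still open; it follows from this very claim by
    subtraction.\<close>
  have close: "\<exists>N. \<forall>n\<ge>N. \<sigma> n - x \<in> l2 \<and> ip_norm l2_inner (\<sigma> n - x) < \<epsilon>" if \<epsilon>: "\<epsilon> > 0" for \<epsilon>
  proof -
    \<comment> \<open>The limit in \<open>m\<close> preserves only a weak inequality; starting from
      \<open>\<epsilon> / 2\<close> leaves room for the strict one.\<close>
    obtain N where N: "\<And>n m. N \<le> n \<Longrightarrow> N \<le> m \<Longrightarrow> ip_dist l2 l2_inner (\<sigma> n) (\<sigma> m) < \<epsilon> / 2"
      using Cauchy[OF half_gt_zero[OF \<epsilon>]] by blast
    have "(\<Sum>i<K. ((\<sigma> n - x) i)\<^sup>2) \<le> (\<epsilon> / 2)\<^sup>2" if "n \<ge> N" for n K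
    proof (rule tendsto_upperbound)
      show "(\<lambda>m. \<Sum>i<K. ((\<sigma> n - \<sigma> m) i)\<^sup>2) \<longlonglongrightarrow> (\<Sum>i<K. ((\<sigma> n - x) i)\<^sup>2)"
        unfolding minus_apply by (intro tendsto_intros x)
      show "\<forall>\<^sub>F m in sequentially. (\<Sum>i<K. ((\<sigma> n - \<sigma> m) i)\<^sup>2) \<le> (\<epsilon> / 2)\<^sup>2"
        using eventually_ge_at_top[of N]
      proof eventually_elim
        case (elim m)
        have d: "\<sigma> n - \<sigma> m \<in> l2"
          using in_l2 subspace_l2 by (simp add: subspace_diff)
        have "(\<Sum>i<K. ((\<sigma> n - \<sigma> m) i)\<^sup>2) \<le> (ip_norm l2_inner (\<sigma> n - \<sigma> m))\<^sup>2"
          by (rule sum_le_l2_norm[OF d])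
        also have "\<dots> \<le> (\<epsilon> / 2)\<^sup>2"
          using N[OF that elim] in_l2 l2.ip_ge_zero[OF d]
          by (intro power_mono) (auto simp: ip_dist_def ip_norm_def)
        finally show ?case .
      qed
    qed simp
    note partial = this
    show ?thesis
    proof (intro exI[of _ N] allI impI)
      fix n assume "n \<ge> N"
      then show "\<sigma> n - x \<in> l2 \<and> ip_norm l2_inner (\<sigma> n - x) < \<epsilon>"
        using l2_norm_leI[of "\<sigma> n - x" "\<epsilon> / 2"] partial \<epsilon> by force
    qed
  qed
  obtain n where "\<sigma> n - x \<in> l2"
    using close[of 1] by auto
  then have "x \<in> l2"
    using subspace_diff[OF subspace_l2 in_l2[of n], of "\<sigma> n - x"] by simp
  with close in_l2 have "limitin l2_metric.mtopology \<sigma> x sequentially"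
    unfolding l2_metric.limit_metric_sequentially by (simp add: ip_dist_def) blast
  then show "\<exists>x. limitin l2_metric.mtopology \<sigma> x sequentially"
    by blast
qed

lemma hilbert_space_on_l2: "hilbert_space_on l2 l2_inner"
  by unfold_locales (rule mcomplete_l2)

lemma continuous_map_l2_coordinate:
  "continuous_map l2_metric.mtopology euclideanreal (\<lambda>x. x i)"
  unfolding l2_metric.continuous_map_from_metric
proof (intro conjI ballI allI impI)
  fix a U assume "a \<in> l2" and "openin euclideanreal U \<and> a i \<in> U"
  then obtain e where "e > 0" and e: "\<And>r. dist r (a i) < e \<Longrightarrow> r \<in> U"
    by (auto simp: open_dist)
  show "\<exists>r>0. \<forall>x. x \<in> l2 \<and> ip_dist l2 l2_inner a x < r \<longrightarrow> x i \<in> U"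
  proof (intro exI[of _ e] conjI allI impI \<open>e > 0\<close>)
    fix x assume "x \<in> l2 \<and> ip_dist l2 l2_inner a x < e"
    then show "x i \<in> U"
      using coordinate_diff_le_l2_dist[of a x i] \<open>a \<in> l2\<close>
      by (intro e) (simp add: dist_real_def abs_minus_commute)
  qed
qed auto

section \<open>The objective function: closedness and convexity\<close>

text \<open>Half the quadratic form of a diagonal operator with eigenvalues
  \<open>1 / (n + 1)\<close>. They tend to 0, so late coordinates are hardly contracted by the
  proximal map; this is the source of the slow convergence.\<close>

definition diag_quad :: "(nat \<Rightarrow> real) \<Rightarrow> real"
  where "diag_quad x = (\<Sum>n. (x n)\<^sup>2 / (real n + 1)) / 2"

lemma summable_diag_quad:
  assumes "x \<in> l2"
  shows "summable (\<lambda>n. (x n)\<^sup>2 / (real n + 1))"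
  by (rule summable_comparison_test'[of "\<lambda>n. (x n)\<^sup>2" 0])
     (use assms in \<open>auto simp: l2_def field_simps\<close>)

lemma diag_quad_nonneg: "x \<in> l2 \<Longrightarrow> 0 \<le> diag_quad x"
  by (simp add: diag_quad_def suminf_nonneg summable_diag_quad)

lemma diag_quad_zero [simp]: "diag_quad 0 = 0"
  by (simp add: diag_quad_def)

text \<open>Partial sums of nonnegative terms increase to the series. The epigraph thus becomes an
  intersection of conditions on finitely many coordinates, each of them closed.\<close>

lemma diag_quad_le_iff:
  assumes "x \<in> l2"
  shows "diag_quad x \<le> r \<longleftrightarrow> (\<forall>K. (\<Sum>n<K. (x n)\<^sup>2 / (real n + 1)) \<le> 2 * r)"
proof
  assume "diag_quad x \<le> r"
  then have "(\<Sum>n. (x n)\<^sup>2 / (real n + 1)) \<le> 2 * r"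
    by (simp add: diag_quad_def)
  moreover have "(\<Sum>n<K. (x n)\<^sup>2 / (real n + 1)) \<le> (\<Sum>n. (x n)\<^sup>2 / (real n + 1))" for K
    by (intro sum_le_suminf summable_diag_quad assms) auto
  ultimately show "\<forall>K. (\<Sum>n<K. (x n)\<^sup>2 / (real n + 1)) \<le> 2 * r"
    using order_trans by blast
next
  assume "\<forall>K. (\<Sum>n<K. (x n)\<^sup>2 / (real n + 1)) \<le> 2 * r"
  then have "(\<Sum>n. (x n)\<^sup>2 / (real n + 1)) \<le> 2 * r"
    by (intro suminf_le_const summable_diag_quad assms) auto
  then show "diag_quad x \<le> r"
    by (simp add: diag_quad_def)
qed

lemma closed_fun_on_diag_quad: "closed_fun_on l2 l2_inner (\<lambda>x. ereal (diag_quad x))"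
proof -
  let ?T = "prod_topology l2_metric.mtopology euclideanreal"
  let ?g = "\<lambda>K p. (\<Sum>n<K. (fst p n)\<^sup>2 / (real n + 1)) - 2 * snd p"
  have coord: "continuous_map ?T euclideanreal (\<lambda>p. fst p n)" for n
    using continuous_map_compose[OF continuous_map_fst continuous_map_l2_coordinate]
    by (simp add: o_def)
  have "continuous_map ?T euclideanreal (?g K)" for K
    \<comment> \<open>Division by \<open>real n + 1\<close> becomes multiplication by a constant, so
      \<open>?g K\<close> is built from coordinates by sums, products and powers only.\<close>
    unfolding divide_inverse
    by (intro continuous_map_diff continuous_map_sum continuous_map_real_mult
        continuous_map_real_pow continuous_map_snd coord) auto
  then have "closedin ?T {p \<in> topspace ?T. ?g K p \<in> {..0}}" for K
    by (rule closedin_continuous_map_preimage) auto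
  then have "closedin ?T (\<Inter>K. {p \<in> topspace ?T. ?g K p \<in> {..0}})"
    by (intro closedin_INT) auto
  also have "(\<Inter>K. {p \<in> topspace ?T. ?g K p \<in> {..0}}) = epigraph_on l2 (\<lambda>x. ereal (diag_quad x))"
    by (auto simp: epigraph_on_def diag_quad_le_iff)
  finally show ?thesis
    by (simp add: closed_fun_on_def)
qed

text \<open>Convexity of the square passes to the series term by term, since the weights
  \<open>1 / (real n + 1)\<close> are positive.\<close>

lemma convex_fun_on_diag_quad: "convex_fun_on l2 (\<lambda>x. ereal (diag_quad x))"
  unfolding convex_fun_on_def
proof (rule convexI)
  fix p q :: "(nat \<Rightarrow> real) \<times> real" and u v :: real
  assume pq: "p \<in> epigraph_on l2 (\<lambda>x. ereal (diag_quad x))" "q \<in> epigraph_on l2 (\<lambda>x. ereal (diag_quad x))"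
    and uv: "0 \<le> u" "0 \<le> v" "u + v = 1"
  obtain x r where p: "p = (x, r)" by (cases p)
  obtain y s where q: "q = (y, s)" by (cases q)
  have xy: "x \<in> l2" "y \<in> l2" and le: "diag_quad x \<le> r" "diag_quad y \<le> s"
    using pq by (auto simp: p q epigraph_on_def)
  have w: "u *\<^sub>R x + v *\<^sub>R y \<in> l2"
    using xy subspace_l2 by (simp add: subspace_add subspace_scale)
  have square: "(u * a + v * b)\<^sup>2 \<le> u * a\<^sup>2 + v * b\<^sup>2" for a b
  proof -
    have "u * a\<^sup>2 + v * b\<^sup>2 - (u * a + v * b)\<^sup>2 = u * v * (a - b)\<^sup>2"
      using uv(3) by algebra
    then show ?thesis
      using uv by (smt (verit) mult_nonneg_nonneg zero_le_power2)
  qed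
  note sx = summable_diag_quad[OF xy(1)] and sy = summable_diag_quad[OF xy(2)]
  have "(\<Sum>n. ((u *\<^sub>R x + v *\<^sub>R y) n)\<^sup>2 / (real n + 1))
      \<le> (\<Sum>n. u * ((x n)\<^sup>2 / (real n + 1)) + v * ((y n)\<^sup>2 / (real n + 1)))"
  proof (rule suminf_le)
    show "((u *\<^sub>R x + v *\<^sub>R y) n)\<^sup>2 / (real n + 1)
        \<le> u * ((x n)\<^sup>2 / (real n + 1)) + v * ((y n)\<^sup>2 / (real n + 1))" for n
      using divide_right_mono[OF square, of "real n + 1" "x n" "y n"]
      by (simp add: add_divide_distrib)
    show "summable (\<lambda>n. ((u *\<^sub>R x + v *\<^sub>R y) n)\<^sup>2 / (real n + 1))"
      by (rule summable_diag_quad[OF w])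
    show "summable (\<lambda>n. u * ((x n)\<^sup>2 / (real n + 1)) + v * ((y n)\<^sup>2 / (real n + 1)))"
      by (intro summable_add summable_mult sx sy)
  qed
  also have "\<dots> = 2 * (u * diag_quad x + v * diag_quad y)"
    unfolding diag_quad_def
    using suminf_add[OF summable_mult[OF sx, of u] summable_mult[OF sy, of v]]
    by (simp add: suminf_mult[OF sx] suminf_mult[OF sy] del: times_divide_eq_right)
  finally have "diag_quad (u *\<^sub>R x + v *\<^sub>R y) \<le> u * diag_quad x + v * diag_quad y"
    by (simp add: diag_quad_def)
  also have "\<dots> \<le> u * r + v * s"
    using le uv by (intro add_mono mult_left_mono) auto
  finally show "u *\<^sub>R p + v *\<^sub>R q \<in> epigraph_on l2 (\<lambda>x. ereal (diag_quad x))"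
    using w by (simp add: p q epigraph_on_def)
qed

section \<open>The proximal map in closed form\<close>

text \<open>Coordinatewise solution \<open>y n\<close> of the stationarity condition
  \<open>y n / (real n + 1) + (y n - x n) / \<gamma> = 0\<close>.\<close>

definition diag_prox :: "real \<Rightarrow> (nat \<Rightarrow> real) \<Rightarrow> nat \<Rightarrow> real"
  where "diag_prox \<gamma> x = (\<lambda>n. x n * ((real n + 1) / (real n + 1 + \<gamma>)))"

lemma diag_prox_in_l2:
  assumes "\<gamma> > 0" "x \<in> l2"
  shows "diag_prox \<gamma> x \<in> l2"
proof -
  have "norm ((diag_prox \<gamma> x n)\<^sup>2) \<le> (x n)\<^sup>2" for n
    using mult_left_mono[of "((real n + 1) / (real n + 1 + \<gamma>))\<^sup>2" 1 "(x n)\<^sup>2"] assms(1)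
    by (simp add: diag_prox_def power_mult_distrib power_le_one del: times_divide_eq_right)
  then show ?thesis
    using assms(2) summable_comparison_test'[of "\<lambda>n. (x n)\<^sup>2" 0 "\<lambda>n. (diag_prox \<gamma> x n)\<^sup>2"]
    by (simp add: l2_def)
qed

text \<open>The objective is a sum of one-variable quadratics, each minimized at the corresponding
  coordinate of \<open>diag_prox \<gamma> x\<close>. A point that differs in some coordinate loses
  strictly there and gains nowhere.\<close>

lemma diag_prox_strict_minimizer:
  assumes \<gamma>: "\<gamma> > 0" and x: "x \<in> l2" and y: "y \<in> l2" "y \<noteq> diag_prox \<gamma> x"
  defines "obj \<equiv> \<lambda>y. diag_quad y + 1 / (2 * \<gamma>) * (ip_norm l2_inner (y - x))\<^sup>2"
  shows "obj (diag_prox \<gamma> x) < obj y"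
proof -
  define p where "p = diag_prox \<gamma> x"
  define h where "h w n = (w n)\<^sup>2 / (real n + 1) / 2 + 1 / (2 * \<gamma>) * (w n - x n)\<^sup>2" for w n
  have p: "p \<in> l2"
    unfolding p_def by (rule diag_prox_in_l2[OF \<gamma> x])
  have h: "summable (h w)" "obj w = suminf (h w)" if "w \<in> l2" for w
  proof -
    have d: "w - x \<in> l2"
      using that x subspace_l2 by (simp add: subspace_diff)
    then have s: "summable (\<lambda>n. (w n - x n)\<^sup>2)"
      by (simp add: l2_def)
    show "summable (h w)"
      unfolding h_def by (intro summable_add summable_mult summable_divide summable_diag_quad s that)
    show "obj w = suminf (h w)"
      unfolding h_def obj_def l2_norm_power2[OF d] diag_quad_def minus_apply
      by (simp only: suminf_add[OF summable_divide[OF summable_diag_quad[OF that]] summable_mult[OF s], symmetric]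
          suminf_mult[OF s] suminf_divide[OF summable_diag_quad[OF that]])
  qed
  \<comment> \<open>Completing the square: \<open>h\<close> is quadratic in the coordinate with
    vertex \<open>p n\<close> and second derivative \<open>1 / (real n + 1) + 1 / \<gamma>\<close>.
    Expressing \<open>x n\<close> through \<open>p n\<close> reduces this to field
    arithmetic.\<close>
  have gap: "h y n = h p n + (1 / (real n + 1) + 1 / \<gamma>) / 2 * (y n - p n)\<^sup>2" for n
  proof -
    define i where "i = real n + 1"
    have "i > 0"
      by (simp add: i_def)
    moreover have "p n = x n * (i / (i + \<gamma>))"
      by (simp add: p_def diag_prox_def i_def)
    then have "x n = p n * (1 + \<gamma> / i)"
      using \<open>i > 0\<close> \<gamma> by (simp add: field_simps)
    ultimately show ?thesis
      unfolding h_def i_def[symmetric] \<open>x n = p n * (1 + \<gamma> / i)\<close>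
      by (insert \<gamma> \<open>i > 0\<close>) (simp add: field_simps power2_eq_square)
  qed
  obtain i where "y i \<noteq> p i"
    using y(2) by (auto simp: p_def fun_eq_iff)
  then have "0 < (\<Sum>n. h y n - h p n)"
    using \<gamma> by (intro suminf_pos2[of _ i] summable_diff h(1) p y(1))
      (auto simp: gap intro!: mult_pos_pos add_pos_pos)
  then show ?thesis
    using suminf_diff[OF h(1)[OF y(1)] h(1)[OF p]] h(2)[OF y(1)] h(2)[OF p]
    by (simp add: p_def)
qed

text \<open>\<open>arg_min\<close> is a choice operator; the strict inequality gives both existence
  and uniqueness of the minimizer and so determines the chosen value.\<close>

lemma prox_diag_quad:
  assumes "\<gamma> > 0" "x \<in> l2"
  shows "prox l2 l2_inner \<gamma> (\<lambda>x. ereal (diag_quad x)) x = diag_prox \<gamma> x"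
  unfolding prox_def arg_min_def is_arg_min_def
proof (rule some_equality, goal_cases)
  case 1
  show ?case
    using diag_prox_strict_minimizer[OF assms] diag_prox_in_l2[OF assms]
    by (auto simp: not_less) (metis less_eq_real_def)
next
  case (2 y)
  then show ?case
    using diag_prox_strict_minimizer[OF assms, of y] diag_prox_in_l2[OF assms] by auto
qed

section \<open>Estimates for sums of powers\<close>

lemma summable_shifted_powr:
  assumes "\<gamma> > 0" "s > 1"
  shows "summable (\<lambda>n. (real n + 1 + \<gamma>) powr - s)"
proof (rule summable_comparison_test'[of _ 1])
  show "summable (\<lambda>n. real n powr - s)"
    using assms by (simp add: summable_real_powr_iff)
  \<comment> \<open>The comparison starts at 1 because \<open>0 powr - s\<close> is 0, which makes
    it fail at \<open>n = 0\<close>.\<close>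
  show "norm ((real n + 1 + \<gamma>) powr - s) \<le> real n powr - s" if "n \<ge> 1" for n
    using assms that by (simp add: powr_mono2')
qed

text \<open>The left side is the integral of the decreasing function \<open>u powr - (s + 1)\<close>
  over \<open>[a, a + 1]\<close>, the right side its value at the left end. The proof avoids
  integrals by using \<open>ln t \<le> t - 1\<close> and \<open>1 + u \<le> exp u\<close>.\<close>

lemma powr_neg_diff_le:
  fixes a s :: real
  assumes "a > 0" "s > 0"
  shows "(a powr - s - (a + 1) powr - s) / s \<le> a powr - (s + 1)"
proof -
  \<comment> \<open>Dividing by \<open>a powr - s\<close> leaves the Bernoulli-type inequality
    \<open>1 - s / a \<le> t powr - s\<close>.\<close>
  define t where "t = (a + 1) / a"
  have t: "t > 0" "t - 1 = 1 / a"
    using assms by (auto simp: t_def field_simps)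
  have "1 - s / a \<le> 1 - s * ln t"
    using ln_le_minus_one[OF t(1)] t(2) mult_left_mono[of "ln t" "1 / a" s] assms by simp
  also have "\<dots> \<le> t powr - s"
    using t(1) exp_ge_add_one_self[of "- s * ln t"] by (simp add: powr_def)
  finally have "a powr - s * (1 - s / a) \<le> a powr - s * t powr - s"
    by (intro mult_left_mono) auto
  also have "\<dots> = (a + 1) powr - s"
    using assms t(1) by (simp add: powr_mult[symmetric] t_def)
  finally have "a powr - s - (a + 1) powr - s \<le> s * (a powr - s / a)"
    by (simp add: field_simps)
  also have "a powr - s / a = a powr - (s + 1)"
    using assms powr_diff[of a "- s" 1] by simp
  finally show ?thesis
    using assms by (simp add: field_simps)
qed

text \<open>The differences \<open>?g n - ?g (Suc n)\<close> telescope to \<open>?g 0\<close>, as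
  \<open>?g\<close> tends to 0, and each is at most the corresponding term on the right.\<close>

lemma powr_tail_ge:
  fixes a s :: real
  assumes "a > 0" "s > 0" "summable (\<lambda>n. (real n + a) powr - (s + 1))"
  shows "a powr - s / s \<le> (\<Sum>n. (real n + a) powr - (s + 1))"
proof -
  let ?g = "\<lambda>n. (real n + a) powr - s / s"
  have "?g \<longlonglongrightarrow> 0 / s"
    using assms(2)
    by (intro tendsto_divide tendsto_const tendsto_neg_powr
        filterlim_at_top_mono[OF filterlim_real_sequentially]) (use assms(1) in auto)
  then have "(\<lambda>n. ?g n - ?g (Suc n)) sums (?g 0 - 0)"
    by (intro telescope_sums') simp
  moreover have "?g n - ?g (Suc n) \<le> (real n + a) powr - (s + 1)" for n
    using powr_neg_diff_le[of "real n + a" s] assms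
    by (simp add: diff_divide_distrib add_ac)
  ultimately show ?thesis
    using sums_le[OF _ _ summable_sums[OF assms(3)]] by fastforce
qed

text \<open>
  With \<open>x = n + 1\<close> this is \<open>(1 + \<gamma> / x) ^ k \<le> exp (k * \<gamma> / x) \<le> exp \<gamma>\<close>.
\<close>

lemma ratio_power_ge_exp:
  assumes "\<gamma> > 0" "k \<le> n + 1"
  shows "exp (- 2 * \<gamma>) \<le> ((real n + 1) / (real n + 1 + \<gamma>)) ^ (2 * k)"
proof -
  define x where "x = real n + 1"
  have x: "x > 0" "real k \<le> x"
    using assms by (auto simp: x_def)
  have "exp (- \<gamma> / x) \<le> x / (x + \<gamma>)"
  proof -
    have "(x + \<gamma>) / x \<le> exp (\<gamma> / x)"
      using exp_ge_add_one_self[of "\<gamma> / x"] x by (simp add: add_divide_distrib)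
    then have "inverse (exp (\<gamma> / x)) \<le> inverse ((x + \<gamma>) / x)"
      using x assms by (intro le_imp_inverse_le) auto
    then show ?thesis
      by (simp add: exp_minus)
  qed
  then have "exp (- \<gamma> / x) ^ (2 * k) \<le> (x / (x + \<gamma>)) ^ (2 * k)"
    by (intro power_mono) auto
  moreover have "exp (- 2 * \<gamma>) \<le> exp (- \<gamma> / x) ^ (2 * k)"
    using x assms by (simp add: exp_of_nat_mult[symmetric] field_simps)
  ultimately show ?thesis
    unfolding x_def by linarith
qed

text \<open>Shared last step of both final bounds: nonnegative terms with \<open>n + 1 < k\<close>
  are dropped, and the rest dominates \<open>c\<close> times a power tail starting at
  \<open>real k + \<gamma>\<close>.\<close>

lemma weighted_powr_sum_ge:
  assumes "\<gamma> > 0" "s > 0" "k \<ge> 1"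
    and le: "\<And>n. n + 1 \<ge> k \<Longrightarrow> c * (real n + 1 + \<gamma>) powr - (s + 1) \<le> w n"
    and w: "summable w" "\<And>n. 0 \<le> w n" and c: "c \<ge> 0"
  shows "c * ((real k + \<gamma>) powr - s / s) \<le> suminf w"
proof -
  \<comment> \<open>Indices start at 0, so the first term with \<open>n + 1 \<ge> k\<close> has
    index \<open>k - 1\<close>. Shifting by \<open>m\<close> turns
    \<open>real n + 1 + \<gamma>\<close> into \<open>real n + (real k + \<gamma>)\<close>.\<close>
  define m where "m = k - 1"
  have k: "real k = real m + 1"
    using \<open>k \<ge> 1\<close> by (simp add: m_def)
  have "summable (\<lambda>n. (real (n + m) + 1 + \<gamma>) powr - (s + 1))"
    using summable_ignore_initial_segment[OF summable_shifted_powr[of \<gamma> "s + 1"], of m] assms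
    by simp
  then have sum: "summable (\<lambda>n. (real n + (real k + \<gamma>)) powr - (s + 1))"
    by (simp add: k add_ac)
  have "c * ((real k + \<gamma>) powr - s / s) \<le> c * (\<Sum>n. (real n + (real k + \<gamma>)) powr - (s + 1))"
    using assms by (intro mult_left_mono powr_tail_ge sum) auto
  also have "\<dots> = (\<Sum>n. c * (real n + (real k + \<gamma>)) powr - (s + 1))"
    by (rule suminf_mult[OF sum, symmetric])
  also have "\<dots> \<le> (\<Sum>n. w (n + m))"
  proof (intro suminf_le summable_mult sum summable_ignore_initial_segment w)
    show "c * (real n + (real k + \<gamma>)) powr - (s + 1) \<le> w (n + m)" for n
      using le[of "n + m"] by (simp add: k m_def add_ac)
  qed
  also have "\<dots> \<le> suminf w"
    using suminf_split_initial_segment[OF w(1), of m] sum_nonneg[of "{..<m}" w] w(2) by simp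
  finally show ?thesis .
qed

section \<open>Explicit iterates and the two lower bounds\<close>

theorem theorem12:
  fixes \<gamma> :: real
  assumes "\<gamma> > 0"
  shows "\<exists>(V :: (nat \<Rightarrow> real) set) (ip :: (nat \<Rightarrow> real) \<Rightarrow> (nat \<Rightarrow> real) \<Rightarrow> real)
            (f :: (nat \<Rightarrow> real) \<Rightarrow> ereal) (xstar :: nat \<Rightarrow> real).
    hilbert_space_on V ip \<and>
    closed_fun_on V ip f \<and> proper_fun_on V f \<and> convex_fun_on V f \<and>
    is_arg_min f (\<lambda>x. x \<in> V) xstar \<and>
    (\<forall>\<alpha>::real. \<alpha> > 1 / 2 \<longrightarrow>
      (\<exists>z0\<in>V. \<forall>z :: nat \<Rightarrow> nat \<Rightarrow> real.
        z 0 = z0 \<and> (\<forall>k. z (Suc k) = prox V ip \<gamma> f (z k)) \<longrightarrow>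
          (\<forall>k\<ge>1. (ip_norm ip (prox V ip \<gamma> f (z k) - z k))\<^sup>2
              \<ge> \<gamma>\<^sup>2 / ((1 + 2 * \<alpha>) * exp (2 * \<gamma>) * (real k + \<gamma>) powr (1 + 2 * \<alpha>))) \<and>
          (\<forall>k. f (z (Suc k)) - f xstar
              \<ge> ereal (1 / (4 * \<alpha> * exp (2 * \<gamma>) * (real k + 1 + \<gamma>) powr (2 * \<alpha>))))))"
proof -
  let ?f = "\<lambda>x. ereal (diag_quad x)"
  \<comment> \<open>The space, the function and its minimizer \<open>0\<close> are fixed before
    \<alpha>; only the starting point depends on it.\<close>
  have "(\<exists>z0\<in>l2. \<forall>z :: nat \<Rightarrow> nat \<Rightarrow> real.
        z 0 = z0 \<and> (\<forall>k. z (Suc k) = prox l2 l2_inner \<gamma> ?f (z k)) \<longrightarrow>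
          (\<forall>k\<ge>1. (ip_norm l2_inner (prox l2 l2_inner \<gamma> ?f (z k) - z k))\<^sup>2
              \<ge> \<gamma>\<^sup>2 / ((1 + 2 * \<alpha>) * exp (2 * \<gamma>) * (real k + \<gamma>) powr (1 + 2 * \<alpha>))) \<and>
          (\<forall>k. ?f (z (Suc k)) - ?f 0
              \<ge> ereal (1 / (4 * \<alpha> * exp (2 * \<gamma>) * (real k + 1 + \<gamma>) powr (2 * \<alpha>)))))"
    if \<alpha>: "\<alpha> > 1 / 2" for \<alpha> :: real
  proof (intro bexI allI impI)
    \<comment> \<open>The squares decay with exponent \<open>2 * \<alpha>\<close>, which exceeds 1
      exactly when \<open>\<alpha> > 1 / 2\<close>; hence \<open>z0 \<in> l2\<close>.\<close>
    define z0 :: "nat \<Rightarrow> real" where "z0 n = (real n + 1 + \<gamma>) powr - \<alpha>" for n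
    have z0_sq: "(z0 n)\<^sup>2 = (real n + 1 + \<gamma>) powr - (2 * \<alpha>)" for n
      using \<open>\<gamma> > 0\<close> by (simp add: z0_def power2_eq_square flip: powr_add)
    show z0: "z0 \<in> l2"
      using summable_shifted_powr[OF \<open>\<gamma> > 0\<close>, of "2 * \<alpha>"] \<alpha> by (simp add: l2_def z0_sq)
    fix z assume z: "z 0 = z0 \<and> (\<forall>k. z (Suc k) = prox l2 l2_inner \<gamma> ?f (z k))"
    have z_l2: "z k \<in> l2" for k
      by (induction k) (use z z0 \<open>\<gamma> > 0\<close> in \<open>auto simp: prox_diag_quad diag_prox_in_l2\<close>)
    have z_eq: "z k n = ((real n + 1) / (real n + 1 + \<gamma>)) ^ k * z0 n" for k n
      by (induction k)
         (use z \<open>\<gamma> > 0\<close> in \<open>simp_all add: prox_diag_quad z_l2 diag_prox_def mult_ac\<close>)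
    have z_sq: "exp (- 2 * \<gamma>) * (real n + 1 + \<gamma>) powr - (2 * \<alpha>) \<le> (z k n)\<^sup>2"
      if "k \<le> n + 1" for k n
      using mult_right_mono[OF ratio_power_ge_exp[OF \<open>\<gamma> > 0\<close> that]]
      by (simp add: z_eq power_mult_distrib z0_sq mult.commute[of k] flip: power_mult)
    show "(\<forall>k\<ge>1. (ip_norm l2_inner (prox l2 l2_inner \<gamma> ?f (z k) - z k))\<^sup>2
              \<ge> \<gamma>\<^sup>2 / ((1 + 2 * \<alpha>) * exp (2 * \<gamma>) * (real k + \<gamma>) powr (1 + 2 * \<alpha>))) \<and>
          (\<forall>k. ?f (z (Suc k)) - ?f 0
              \<ge> ereal (1 / (4 * \<alpha> * exp (2 * \<gamma>) * (real k + 1 + \<gamma>) powr (2 * \<alpha>))))"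
    proof (intro conjI allI impI)
      fix k :: nat assume "k \<ge> 1"
      define d where "d = diag_prox \<gamma> (z k) - z k"
      have d: "d \<in> l2"
        unfolding d_def using z_l2 \<open>\<gamma> > 0\<close> subspace_l2 by (simp add: subspace_diff diag_prox_in_l2)
      \<comment> \<open>A proximal step changes coordinate \<open>n\<close> by the factor
        \<open>- \<gamma> / (real n + 1 + \<gamma>)\<close>. Squared, this raises the decay exponent
        from \<open>2 * \<alpha>\<close> to \<open>2 * \<alpha> + 2\<close>, so the tail bound
        applies with \<open>s = 1 + 2 * \<alpha>\<close>.\<close>
      have d_sq: "(d n)\<^sup>2 = \<gamma>\<^sup>2 * ((z k n)\<^sup>2 * (real n + 1 + \<gamma>) powr - 2)" for n
      proof -
        have "d n = - \<gamma> * (z k n / (real n + 1 + \<gamma>))"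
          using \<open>\<gamma> > 0\<close> by (simp add: d_def diag_prox_def field_simps)
        then show ?thesis
          using \<open>\<gamma> > 0\<close>
          by (simp add: power_mult_distrib power_divide powr_minus powr_numeral divide_inverse
              power_inverse)
      qed
      have "\<gamma>\<^sup>2 * exp (- 2 * \<gamma>) * ((real k + \<gamma>) powr - (1 + 2 * \<alpha>) / (1 + 2 * \<alpha>)) \<le> (\<Sum>n. (d n)\<^sup>2)"
      proof (rule weighted_powr_sum_ge)
        fix n assume "k \<le> n + 1"
        have "(real n + 1 + \<gamma>) powr - (1 + 2 * \<alpha> + 1)
            = (real n + 1 + \<gamma>) powr - (2 * \<alpha>) * (real n + 1 + \<gamma>) powr - 2"
          by (simp add: algebra_simps flip: powr_add)
        then show "\<gamma>\<^sup>2 * exp (- 2 * \<gamma>) * (real n + 1 + \<gamma>) powr - (1 + 2 * \<alpha> + 1) \<le> (d n)\<^sup>2"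
          using mult_right_mono[OF z_sq[OF \<open>k \<le> n + 1\<close>], of "(real n + 1 + \<gamma>) powr - 2"]
          by (simp add: d_sq mult.assoc mult_left_mono)
      qed (use d \<alpha> \<open>\<gamma> > 0\<close> \<open>k \<ge> 1\<close> in \<open>auto simp: l2_def\<close>)
      then show "(ip_norm l2_inner (prox l2 l2_inner \<gamma> ?f (z k) - z k))\<^sup>2
              \<ge> \<gamma>\<^sup>2 / ((1 + 2 * \<alpha>) * exp (2 * \<gamma>) * (real k + \<gamma>) powr (1 + 2 * \<alpha>))"
        unfolding prox_diag_quad[OF \<open>\<gamma> > 0\<close> z_l2] d_def[symmetric] l2_norm_power2[OF d]
        by (simp only: powr_minus exp_minus mult_minus_left mult_minus_right divide_inverse inverse_mult_distrib mult_ac)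
    next
      fix k :: nat
      \<comment> \<open>Here \<open>s = 2 * \<alpha>\<close> and the index is \<open>Suc k\<close>;
        the factor 1/2 in \<open>diag_quad\<close> later turns \<open>2 * \<alpha>\<close> into
        \<open>4 * \<alpha>\<close>.\<close>
      have "exp (- 2 * \<gamma>) * ((real (Suc k) + \<gamma>) powr - (2 * \<alpha>) / (2 * \<alpha>))
          \<le> (\<Sum>n. (z (Suc k) n)\<^sup>2 / (real n + 1))"
      proof (rule weighted_powr_sum_ge)
        fix n assume n: "Suc k \<le> n + 1"
        \<comment> \<open>Lowering the weight \<open>1 / (real n + 1)\<close> to
          \<open>1 / (real n + 1 + \<gamma>)\<close> merges it with the power of the same
          base.\<close>
        have "exp (- 2 * \<gamma>) * (real n + 1 + \<gamma>) powr - (2 * \<alpha> + 1)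
            = exp (- 2 * \<gamma>) * (real n + 1 + \<gamma>) powr - (2 * \<alpha>) / (real n + 1 + \<gamma>)"
          using \<open>\<gamma> > 0\<close> powr_diff[of "real n + 1 + \<gamma>" "- (2 * \<alpha>)" 1] by simp
        also have "\<dots> \<le> (z (Suc k) n)\<^sup>2 / (real n + 1)"
          using \<open>\<gamma> > 0\<close> by (intro frac_le z_sq n) auto
        finally show "exp (- 2 * \<gamma>) * (real n + 1 + \<gamma>) powr - (2 * \<alpha> + 1)
            \<le> (z (Suc k) n)\<^sup>2 / (real n + 1)" .
      qed (use \<alpha> \<open>\<gamma> > 0\<close> summable_diag_quad[OF z_l2] in auto)
      then have "1 / (4 * \<alpha> * exp (2 * \<gamma>) * (real k + 1 + \<gamma>) powr (2 * \<alpha>)) \<le> diag_quad (z (Suc k))"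
        using \<alpha> by (simp add: diag_quad_def powr_minus exp_minus field_simps)
      then show "?f (z (Suc k)) - ?f 0
              \<ge> ereal (1 / (4 * \<alpha> * exp (2 * \<gamma>) * (real k + 1 + \<gamma>) powr (2 * \<alpha>)))"
        by simp
    qed
  qed
  moreover have "proper_fun_on l2 ?f"
    unfolding proper_fun_on_def using subspace_0[OF subspace_l2] by auto
  moreover have "is_arg_min ?f (\<lambda>x. x \<in> l2) 0"
    using subspace_0[OF subspace_l2] diag_quad_nonneg by (auto simp: is_arg_min_def not_less)
  ultimately show ?thesis
    using hilbert_space_on_l2 closed_fun_on_diag_quad convex_fun_on_diag_quad by blast
qed

end
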